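(* Let $q$ be an odd prime power and let $G$ be a graph with $k$ vertices. Then $\widetilde{i}_P(G)\le\lceil\log_3\log_q k\rceil$.
   Context: For a prime power $r\equiv1\pmod 4$, the Paley graph $P(r)$ has vertex set $\mathbb{F}_r$, with $u,v$ adjacent iff $u-v$ is a nonzero square in $\mathbb{F}_r$. For $n\ge1$ let $P_n=P((q^2)^{3^n})$, and let $\widetilde{i}_P(G)=\min\{n\ge1 : G\text{ is a (not necessarily induced) subgraph of }P_n\}$.
   Formalization: The bound is stated as max(1, ⌈log_3 log_q k⌉), since the index is at least 1 by definition while for k ≤ q the stated right-hand side is ≤ 0 or undefined (e.g. k = q gives 0); for k > q it is the original bound. *)

theory Defs
  imports
    Complex_Main
    "HOL-Library.Extended_Nat"
    "HOL-Number_Theory.Prime_Powers"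
    "HOL-Algebra.Ring"
    "HOL-Algebra.Coset"
    "Graph_Theory.Pair_Digraph"
    "Graph_Theory.Digraph_Isomorphism"
begin

(* The field with r elements is unique up to isomorphism. For a prime power r it has a copy
   whose carrier consists of natural numbers, and one such copy is fixed here. *)
definition finite_field :: "nat \<Rightarrow> nat ring" where
  "finite_field r = (SOME F. field F \<and> finite (carrier F) \<and> order F = r)"

(* Undirected graphs are symmetric sets of arcs. The arc set below is symmetric when -1 is a
   square, as it is for prime powers r congruent to 1 modulo 4. *)
definition paley_graph :: "nat \<Rightarrow> nat pair_pre_digraph" where
  "paley_graph r = (let F = finite_field r in
     \<lparr> pverts = carrier F,
       parcs = {(u, v). u \<in> carrier F \<and> v \<in> carrier F \<and> u \<ominus>\<^bsub>F\<^esub> v \<noteq> \<zero>\<^bsub>F\<^esub> \<and>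
                        (\<exists>x \<in> carrier F. u \<ominus>\<^bsub>F\<^esub> v = x [^]\<^bsub>F\<^esub> (2::nat))} \<rparr>)"

definition is_subgraph_of :: "'a pair_pre_digraph \<Rightarrow> 'b pair_pre_digraph \<Rightarrow> bool" where
  "is_subgraph_of G P \<longleftrightarrow>
     (\<exists>H. subgraph H (with_proj P) \<and> digraph_iso (with_proj G) H)"

definition paley_seq :: "nat \<Rightarrow> nat \<Rightarrow> nat pair_pre_digraph" where
  "paley_seq q n = paley_graph ((q\<^sup>2) ^ (3 ^ n))"

(* The infimum in enat is the minimum of a nonempty set and is infinite for the empty set, so
   a finite bound on the index includes the existence of a suitable n. *)
definition paley_index :: "nat \<Rightarrow> 'a pair_pre_digraph \<Rightarrow> enat" where
  "paley_index q G = Inf (enat ` {n. n \<ge> 1 \<and> is_subgraph_of G (paley_seq q n)})"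

end

theory Submission
  imports
    Defs
    "HOL-Number_Theory.Residues"
    "HOL-Algebra.Algebraic_Closure"
    "HOL-Algebra.Weak_Morphisms"
    "HOL-Algebra.Multiplicative_Group"
begin

text \<open>Write \<open>s = q ^ 3 ^ n\<close>. The field with \<open>s\<^sup>2\<close> elements contains the subfield of the \<open>s\<close> fixed
  points of \<open>x \<mapsto> x ^ s\<close>, and each of these is a square since a nonzero one is a power of a generator
  with exponent divisible by the even number \<open>s + 1\<close>. As the subfield is closed under subtraction,
  it is a clique of size \<open>s\<close> in the Paley graph, and \<open>n \<ge> log\<^sub>3 (log\<^sub>q k)\<close> gives \<open>k \<le> s\<close>. The
  field itself is the set of roots of \<open>X ^ r - X\<close> in an algebraic closure of the prime field.\<close>

section \<open>The Frobenius endomorphism\<close>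

text \<open>Induction on the exponent: multiplying the sum by \<open>x\<close> and by
  \<open>y\<close> and adding the coefficients of equal monomials is Pascal's rule.\<close>

lemma (in cring) binomial_expansion:
  assumes x: "x \<in> carrier R" and y: "y \<in> carrier R"
  shows "(x \<oplus> y) [^] n = (\<Oplus>i\<in>{..n}. [(n choose i)] \<cdot> (x [^] i \<otimes> y [^] (n - i)))"
proof (induction n)
  case 0
  show ?case using x y by simp
next
  case (Suc n)
  \<comment> \<open>Keeping the coefficient apart from the exponents turns Pascal's rule into
    additivity in the first argument, \<open>t_add\<close>.\<close>
  define t where "t c i j = [c] \<cdot> (x [^] i \<otimes> y [^] j)" for c i j :: nat
  have t: "t c i j \<in> carrier R" for c i j
    using x y by (simp add: t_def)
  have tx: "t c i j \<otimes> x = t c (Suc i) j" and ty: "t c i j \<otimes> y = t c i (Suc j)" for c i j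
    using x y by (simp_all add: t_def add_pow_ldistr add_pow_rdistr m_assoc m_comm[of _ x])
  have t_add: "t (c + d) i j = t c i j \<oplus> t d i j" for c d i j
    using x y by (simp add: t_def add.nat_pow_mult)
  have t0: "t 0 i j = \<zero>" for i j
    by (simp add: t_def)
  define S where "S = (\<Oplus>i\<in>{..n}. t (n choose i) i (n - i))"
  have Sx: "S \<otimes> x = (\<Oplus>i\<in>{..n}. t (n choose i) (Suc i) (n - i))"
    unfolding S_def using t x by (simp add: finsum_ldistr tx)
  have "S \<otimes> y = (\<Oplus>i\<in>{..n}. t (n choose i) i (n - i) \<otimes> y)"
    unfolding S_def using t y by (simp add: finsum_ldistr)
  also have "\<dots> = (\<Oplus>i\<in>{..n}. t (n choose i) i (Suc n - i))"
    using t by (intro finsum_cong') (auto simp: ty Suc_diff_le)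
  \<comment> \<open>The new top term is zero since \<open>n choose Suc n = 0\<close>. Splitting off
    the term at index 0 then aligns this sum with that of \<open>Sx\<close>.\<close>
  also have "\<dots> = (\<Oplus>i\<in>{..Suc n}. t (n choose i) i (Suc n - i))"
    using t by (simp add: finsum_Suc t0 binomial_eq_0)
  also have "\<dots> = (\<Oplus>i\<in>{..n}. t (n choose Suc i) (Suc i) (n - i)) \<oplus> t 1 0 (Suc n)"
    using t by (subst finsum_Suc2) auto
  finally have Sy: "S \<otimes> y = \<dots>" .
  have "(\<Oplus>i\<in>{..Suc n}. t (Suc n choose i) i (Suc n - i)) =
      (\<Oplus>i\<in>{..n}. t (Suc n choose Suc i) (Suc i) (n - i)) \<oplus> t 1 0 (Suc n)"
    using t by (subst finsum_Suc2) auto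
  also have "\<dots> = S \<otimes> x \<oplus> S \<otimes> y"
    unfolding Sx Sy using t by (simp add: t_add finsum_addf a_assoc)
  also have "\<dots> = S \<otimes> (x \<oplus> y)"
    using x y t by (simp add: r_distr S_def)
  also have "\<dots> = (x \<oplus> y) [^] Suc n"
    using Suc.IH by (simp add: S_def t_def)
  finally show ?case
    by (simp add: t_def)
qed

lemma (in cring) add_pow_eq_zero_of_dvd:
  fixes p n :: nat
  assumes "[p] \<cdot> \<one> = \<zero>" and "p dvd n" and x: "x \<in> carrier R"
  shows "[n] \<cdot> x = \<zero>"
proof -
  obtain m where n: "n = p * m" using assms(2) by (elim dvdE)
  have "[p] \<cdot> x = ([p] \<cdot> \<one>) \<otimes> x"
    using x by (simp add: add_pow_ldistr)
  then have "[p] \<cdot> x = \<zero>"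
    using assms(1) x by simp
  then show ?thesis
    using x add.nat_pow_pow[of x m p] by (simp add: n)
qed

text \<open>A prime divides its inner binomial coefficients, so in characteristic \<open>p\<close>
  only the two end terms of the expansion survive.\<close>

lemma (in cring) frobenius_add:
  fixes p :: nat
  assumes p: "Factorial_Ring.prime p" and char: "[p] \<cdot> \<one> = \<zero>"
    and x: "x \<in> carrier R" and y: "y \<in> carrier R"
  shows "(x \<oplus> y) [^] p = x [^] p \<oplus> y [^] p"
proof -
  obtain m where m: "p = Suc (Suc m)"
    using prime_ge_2_nat[OF p] by (metis add_2_eq_Suc le_Suc_ex)
  let ?t = "\<lambda>i. [(p choose i)] \<cdot> (x [^] i \<otimes> y [^] (p - i))"
  have t: "?t i \<in> carrier R" for i
    using x y by simp
  have mid: "?t (Suc i) = \<zero>" if "i \<le> m" for i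
  proof (rule add_pow_eq_zero_of_dvd[OF char])
    show "p dvd (p choose Suc i)"
      using that p by (intro dvd_choose_prime) (auto simp: m)
  qed (use x y in simp)
  have "(x \<oplus> y) [^] p = (\<Oplus>i\<in>{..Suc (Suc m)}. ?t i)"
    using binomial_expansion[OF x y, of p] by (simp only: m)
  also have "\<dots> = ?t (Suc (Suc m)) \<oplus> ((\<Oplus>i\<in>{..m}. ?t (Suc i)) \<oplus> ?t 0)"
    using t by (subst finsum_Suc, blast, subst finsum_Suc2) auto
  also have "(\<Oplus>i\<in>{..m}. ?t (Suc i)) = (\<Oplus>i\<in>{..m}. \<zero>)"
  proof (intro finsum_cong')
    show "?t (Suc i) = \<zero>" if "i \<in> {..m}" for i
      using that by (intro mid) simp
  qed auto
  also have "?t (Suc (Suc m)) \<oplus> ((\<Oplus>i\<in>{..m}. \<zero>) \<oplus> ?t 0) = x [^] p \<oplus> y [^] p"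
    using x y by (simp add: m finsum_zero del: nat_pow_Suc)
  finally show ?thesis .
qed

lemma (in cring) frobenius_pow_add:
  fixes p :: nat
  assumes p: "Factorial_Ring.prime p" and char: "[p] \<cdot> \<one> = \<zero>"
    and x: "x \<in> carrier R" and y: "y \<in> carrier R"
  shows "(x \<oplus> y) [^] (p ^ e) = x [^] (p ^ e) \<oplus> y [^] (p ^ e)"
proof (induction e)
  case 0
  show ?case using x y by simp
next
  case (Suc e)
  have "(x \<oplus> y) [^] (p ^ Suc e) = ((x \<oplus> y) [^] (p ^ e)) [^] p"
    using x y by (simp add: nat_pow_pow mult.commute)
  also have "\<dots> = (x [^] (p ^ e)) [^] p \<oplus> (y [^] (p ^ e)) [^] p"
    using x y by (simp add: Suc frobenius_add[OF p char])
  finally show ?case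
    using x y by (simp add: nat_pow_pow mult.commute)
qed

text \<open>Additivity is applied to \<open>x = (x \<ominus> y) \<oplus> y\<close>. This avoids a
  sign \<open>(-1) ^ (p ^ e)\<close> and hence a case distinction on the parity of
  \<open>p\<close>.\<close>

lemma (in cring) frobenius_pow_diff:
  fixes p :: nat
  assumes p: "Factorial_Ring.prime p" and char: "[p] \<cdot> \<one> = \<zero>"
    and x: "x \<in> carrier R" and y: "y \<in> carrier R"
  shows "(x \<ominus> y) [^] (p ^ e) = x [^] (p ^ e) \<ominus> y [^] (p ^ e)"
proof -
  have "x [^] (p ^ e) = ((x \<ominus> y) \<oplus> y) [^] (p ^ e)"
    using x y by (simp add: minus_eq a_assoc l_neg)
  also have "\<dots> = (x \<ominus> y) [^] (p ^ e) \<oplus> y [^] (p ^ e)"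
    using x y by (intro frobenius_pow_add[OF p char]) auto
  finally show ?thesis
    using x y by (simp add: minus_eq a_assoc r_neg)
qed

text \<open>The group order annihilates \<open>\<one>\<close> in the additive group. Since
  \<open>[(p ^ m)] \<cdot> \<one>\<close> is the \<open>m\<close>-th power of
  \<open>[p] \<cdot> \<one>\<close> and a field has no nonzero nilpotents, \<open>p\<close> itself
  annihilates \<open>\<one>\<close>.\<close>

lemma (in field) char_eq_of_order:
  fixes p :: nat
  assumes fin: "finite (carrier R)" and ord: "order R = p ^ m"
  shows "[p] \<cdot> \<one> = \<zero>"
proof -
  have pow: "[(p ^ i)] \<cdot> \<one> = ([p] \<cdot> \<one>) [^] i" for i :: nat
  proof (induction i)
    case 0
    show ?case by (simp add: add.nat_pow_eone)
  next
    case (Suc i)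
    have "[(p ^ Suc i)] \<cdot> \<one> = [p] \<cdot> ([(p ^ i)] \<cdot> \<one>)"
      by (simp add: add.nat_pow_pow mult.commute)
    also have "\<dots> = ([(p ^ i)] \<cdot> \<one>) \<otimes> ([p] \<cdot> \<one>)"
      by (simp add: add_pow_rdistr)
    finally show ?case by (simp add: Suc)
  qed
  have "[order R] \<cdot> \<one> = \<zero>"
    using add.pow_order_eq_1[of \<one>] fin by (simp add: order_def)
  then have "([p] \<cdot> \<one>) [^] m = \<zero>"
    by (simp add: ord pow)
  moreover have "a = \<zero>" if "a \<in> carrier R" and "a [^] i = \<zero>" for a and i :: nat
    using that by (induction i) (auto simp: integral_iff)
  ultimately show ?thesis
    by simp
qed


section \<open>A clique of square differences\<close>

text \<open>A generator \<open>a\<close> of the unit group has order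
  \<open>(s - 1) * (s + 1)\<close>, so \<open>a [^] i\<close> is fixed exactly when
  \<open>s + 1\<close> divides \<open>i\<close>. This criterion both counts fixed points and shows
  that their exponents are even.\<close>

lemma (in field) frobenius_fixed_points_clique:
  fixes p e :: nat
  defines "s \<equiv> p ^ e"
  defines "K \<equiv> {x \<in> carrier R. x [^] s = x}"
  assumes fin: "finite (carrier R)" and p: "Factorial_Ring.prime p" "odd p" and e: "e > 0"
    and ord: "order R = s\<^sup>2"
  shows "s \<le> card K"
    and "\<And>u v. u \<in> K \<Longrightarrow> v \<in> K \<Longrightarrow> \<exists>z\<in>carrier R. u \<ominus> v = z [^] (2::nat)"
proof -
  have char: "[p] \<cdot> \<one> = \<zero>"
    using char_eq_of_order[OF fin, of p "e * 2"] ord by (simp add: s_def power_mult)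
  have "odd s" using p by (simp add: s_def)
  have "p \<le> s" using e p prime_gt_0_nat[of p] by (simp add: s_def self_le_power)
  then have s2: "s \<ge> 2" using prime_ge_2_nat[OF p(1)] by simp
  have s1: "s\<^sup>2 - 1 = (s - 1) * (s + 1)"
    using s2 by (simp add: power2_eq_square algebra_simps)
  interpret G: group "Multiplicative_Group.mult_of R"
    rewrites "([^]\<^bsub>Multiplicative_Group.mult_of R\<^esub>) = (([^]) :: _ \<Rightarrow> nat \<Rightarrow> _)" and "\<one>\<^bsub>Multiplicative_Group.mult_of R\<^esub> = \<one>"
    by (rule field_mult_group) (simp_all add: Multiplicative_Group.nat_pow_mult_of)
  obtain a where a: "a \<in> carrier (Multiplicative_Group.mult_of R)"
    and gen: "carrier (Multiplicative_Group.mult_of R) = {a [^] i | i::nat. i \<in> UNIV}"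
    using finite_field_mult_group_has_gen[OF fin] by blast
  have aR: "a \<in> carrier R" and a0: "a [^] i \<noteq> \<zero>" for i :: nat
    using a G.nat_pow_closed[OF a, of i] by auto
  \<comment> \<open>By \<open>gen\<close> every unit is a power of \<open>a\<close>, and exponents
    can be reduced to those below the order of \<open>a\<close>.\<close>
  have "G.ord a = card (carrier (Multiplicative_Group.mult_of R))"
  proof (rule antisym)
    show "G.ord a \<le> card (carrier (Multiplicative_Group.mult_of R))"
      using G.ord_le_group_order[OF finite_mult_of[OF fin] a] by (simp only: order_def)
    have "carrier (Multiplicative_Group.mult_of R) = (\<lambda>i. a [^] i) ` {0..G.ord a - 1}"
      using gen G.ord_elems[OF finite_mult_of[OF fin] a] by auto
    then have "card (carrier (Multiplicative_Group.mult_of R)) \<le> card {0..G.ord a - 1}"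
      by (metis card_image_le finite_atLeastAtMost)
    also have "\<dots> = G.ord a"
      using G.ord_ge_1[OF finite_mult_of[OF fin] a] by simp
    finally show "card (carrier (Multiplicative_Group.mult_of R)) \<le> G.ord a" .
  qed
  also have "\<dots> = (s - 1) * (s + 1)"
    using order_mult_of[OF fin] by (simp only: order_def[of "Multiplicative_Group.mult_of R"] ord s1)
  finally have ord_a: "G.ord a = (s - 1) * (s + 1)" .
  have fixed_iff: "(a [^] i) [^] s = a [^] i \<longleftrightarrow> s + 1 dvd i" for i :: nat
  proof -
    \<comment> \<open>Cancelling \<open>a [^] i\<close> reduces fixedness to
      \<open>a [^] (i * (s - 1)) = \<one>\<close>, which the order of \<open>a\<close>
      decides.\<close>
    have "(a [^] i) [^] s = a [^] i \<otimes> a [^] (i * (s - 1))"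
      using s2 aR by (simp add: nat_pow_pow nat_pow_mult diff_mult_distrib2)
    then have "(a [^] i) [^] s = a [^] i \<longleftrightarrow> a [^] (i * (s - 1)) = \<one>"
      using aR a0[of i] m_lcancel[of "a [^] i" "a [^] (i * (s - 1))" \<one>] by simp
    also have "\<dots> \<longleftrightarrow> (s - 1) * (s + 1) dvd (s - 1) * i"
      using G.pow_eq_id[OF a] by (simp only: ord_a mult.commute[of i])
    also have "\<dots> \<longleftrightarrow> s + 1 dvd i"
      using s2 by (intro nat_mult_dvd_cancel1) simp
    finally show ?thesis .
  qed

  \<comment> \<open>For \<open>j < s - 1\<close> the exponents stay below the order of
    \<open>a\<close>, so the values are distinct. Together with zero they make up \<open>s\<close>
    fixed points.\<close>
  define f where "f j = a [^] ((s + 1) * j)" for j :: nat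
  have "inj_on f {..<s - 1}"
  proof (rule inj_onI)
    fix i j assume ij: "i \<in> {..<s - 1}" "j \<in> {..<s - 1}" and "f i = f j"
    moreover have "(s + 1) * k \<in> {0..G.ord a - 1}" if "k \<in> {..<s - 1}" for k
    proof -
      have "(s + 1) * k < (s + 1) * (s - 1)"
        using that by (intro mult_strict_left_mono) auto
      then show ?thesis by (simp add: ord_a mult.commute)
    qed
    ultimately have "(s + 1) * i = (s + 1) * j"
      using G.ord_inj[OF a] unfolding f_def inj_on_def by blast
    then show "i = j" by (metis Suc_eq_plus1 Suc_mult_cancel1)
  qed
  moreover have "\<zero> \<notin> f ` {..<s - 1}"
    using a0 unfolding f_def by (metis imageE)
  ultimately have "card (insert \<zero> (f ` {..<s - 1})) = s"
    using s2 by (simp add: card_image)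
  moreover have "insert \<zero> (f ` {..<s - 1}) \<subseteq> K"
  proof -
    have "f j \<in> K" for j
      unfolding K_def f_def mem_Collect_eq
      using fixed_iff[of "(s + 1) * j"] aR by (metis dvd_triv_left nat_pow_closed)
    moreover have "\<zero> \<in> K"
      using s2 by (simp add: K_def nat_pow_zero)
    ultimately show ?thesis by blast
  qed
  ultimately show "s \<le> card K"
    using card_mono[of K "insert \<zero> (f ` {..<s - 1})"] fin by (simp add: K_def)

  fix u v assume "u \<in> K" "v \<in> K"
  then have uv: "u \<in> carrier R" "v \<in> carrier R" "u [^] s = u" "v [^] s = v"
    by (auto simp: K_def)
  have fixed: "(u \<ominus> v) [^] s = u \<ominus> v"
    using frobenius_pow_diff[OF p(1) char uv(1,2), of e] uv(3,4) by (simp add: s_def)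
  show "\<exists>z\<in>carrier R. u \<ominus> v = z [^] (2::nat)"
  proof (cases "u \<ominus> v = \<zero>")
    case True
    then show ?thesis by (intro bexI[of _ \<zero>]) (auto simp: nat_pow_zero)
  next
    case False
    then have "u \<ominus> v \<in> carrier (Multiplicative_Group.mult_of R)"
      using uv by simp
    then obtain i :: nat where i: "u \<ominus> v = a [^] i"
      using gen by blast
    have "s + 1 dvd i"
      using fixed fixed_iff[of i] by (simp only: i)
    then have "even i"
      using \<open>odd s\<close> by (meson dvd_trans even_plus_one_iff)
    then obtain j where "i = j * 2"
      by (metis dvdE mult.commute)
    then show ?thesis
      using i aR by (intro bexI[of _ "a [^] j"]) (simp_all add: nat_pow_pow)
  qed
qed


section \<open>Existence of finite fields\<close>

lemma (in field) frobenius_fixed_points_subfield: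
  fixes p e :: nat
  assumes p: "Factorial_Ring.prime p" and char: "[p] \<cdot> \<one> = \<zero>"
  shows "subfield {x \<in> carrier R. x [^] (p ^ e) = x} R"
proof (rule subfieldI')
  \<comment> \<open>A nonzero exponent ensures that zero is a fixed point, since
    \<open>\<zero> [^] 0\<close> is \<open>\<one>\<close>. Closure under negation uses this through
    \<open>\<zero> \<ominus> h\<close>.\<close>
  have q: "p ^ e \<noteq> 0"
    using prime_gt_0_nat[OF p] by simp
  show "subring {x \<in> carrier R. x [^] (p ^ e) = x} R"
  proof (rule subringI)
    fix h assume "h \<in> {x \<in> carrier R. x [^] (p ^ e) = x}"
    then show "\<ominus> h \<in> {x \<in> carrier R. x [^] (p ^ e) = x}"
      using frobenius_pow_diff[OF p char zero_closed, of h e] q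
      by (simp add: minus_eq nat_pow_zero)
  qed (auto simp: frobenius_pow_add[OF p char] nat_pow_distrib)
  fix k assume "k \<in> {x \<in> carrier R. x [^] (p ^ e) = x} - {\<zero>}"
  then have k: "k \<in> Units R" "k [^] (p ^ e) = k"
    by (auto simp: field_Units)
  then have "inv k [^] (p ^ e) = inv (k [^] (p ^ e))"
    by (metis Units_closed Units_inv_closed Units_l_inv Units_pow_closed Units_r_inv inv_unique'
        m_comm nat_pow_closed nat_pow_distrib nat_pow_one)
  then show "inv k \<in> {x \<in> carrier R. x [^] (p ^ e) = x}"
    using k by simp
qed

text \<open>Rearranging gives \<open>y \<otimes> y \<otimes> (z \<ominus> g) = y\<close>. In a
  domain, cancelling a nonzero \<open>y\<close> then makes \<open>y\<close> a unit; this is applied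
  to the polynomial X - a.\<close>

lemma (in cring) cancel_square_step:
  assumes "y \<in> carrier R" "z \<in> carrier R" "g \<in> carrier R"
    and "y \<otimes> y \<otimes> z \<ominus> y = y \<otimes> y \<otimes> g"
  shows "y \<otimes> (y \<otimes> (z \<ominus> g)) = y \<otimes> \<one>"
proof -
  have "y \<otimes> (y \<otimes> (z \<ominus> g)) = (y \<otimes> y \<otimes> z \<ominus> y) \<ominus> y \<otimes> y \<otimes> g \<oplus> y \<otimes> \<one>"
    using assms(1-3) by algebra
  also have "\<dots> = y \<otimes> y \<otimes> g \<ominus> y \<otimes> y \<otimes> g \<oplus> y \<otimes> \<one>"
    by (simp only: assms(4))
  also have "\<dots> = y \<otimes> \<one>"
    using assms(1-3) by algebra
  finally show ?thesis .
qed

text \<open>If \<open>a\<close> is a root, then the Frobenius identity in the polynomial ring gives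
  \<open>X\<^sup>q - X = (X - a)\<^sup>q - (X - a)\<close>, in which \<open>X - a\<close> occurs exactly once.\<close>

lemma (in algebraically_closed) card_frobenius_fixed_points:
  fixes p e :: nat
  defines "q \<equiv> p ^ e"
  assumes p: "Factorial_Ring.prime p" and char: "[p] \<cdot> \<one> = \<zero>" and e: "e > 0"
  shows "card {x \<in> carrier L. x [^] q = x} = q"
proof -
  have "p \<le> q" using e prime_gt_0_nat[OF p] by (simp add: q_def self_le_power)
  then have q2: "q \<ge> 2" using prime_ge_2_nat[OF p] by simp
  interpret UP: domain "poly_ring L"
    using univ_poly_is_domain[OF carrier_is_subring] .
  interpret C: ring_hom_ring L "poly_ring L" poly_of_const
    using canonical_embedding_ring_hom[OF carrier_is_subring] by simp
  \<comment> \<open>Constants carry the characteristic into the polynomial ring, where the Frobenius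
    identities can then be used.\<close>
  have C_add_pow: "poly_of_const ([n] \<cdot> x) = [n] \<cdot>\<^bsub>poly_ring L\<^esub> poly_of_const x"
    if "x \<in> carrier L" for n :: nat and x
    using that by (induction n) (auto simp: UP.add.nat_pow_Suc)
  have char': "[p] \<cdot>\<^bsub>poly_ring L\<^esub> \<one>\<^bsub>poly_ring L\<^esub> = \<zero>\<^bsub>poly_ring L\<^esub>"
    using C_add_pow[OF one_closed, of p] char by simp
  let ?U = "poly_ring L"
  have X: "X \<in> carrier ?U"
    using var_closed(1)[OF carrier_is_subring] .
  define P where "P = X [^]\<^bsub>?U\<^esub> q \<ominus>\<^bsub>?U\<^esub> X"
  have P: "P \<in> carrier ?U" using X by (simp add: P_def)
  have "degree P = q"
  proof -
    have "degree (X [^]\<^bsub>?U\<^esub> q) = q"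
      using polynomial_pow_degree[OF X, of q] by (simp add: var_def)
    moreover have "degree (\<ominus>\<^bsub>?U\<^esub> X) = 1"
      using univ_poly_a_inv_degree[OF carrier_is_subring X] by (simp add: var_def)
    ultimately show ?thesis
      using poly_add_degree_eq[OF carrier_is_subring, of "X [^]\<^bsub>?U\<^esub> q" "\<ominus>\<^bsub>?U\<^esub> X"] q2 X
        UP.nat_pow_closed[OF X, of q] UP.a_inv_closed[OF X]
      by (simp add: P_def a_minus_def univ_poly_add univ_poly_carrier)
  qed
  then have P0: "P \<noteq> []" using q2 by auto
  have eval_P: "eval P x = x [^] q \<ominus> x" if x: "x \<in> carrier L" for x
  proof -
    interpret E: ring_hom_ring ?U L "\<lambda>f. eval f x"
      using eval_ring_hom[OF carrier_is_subring x] .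
    show ?thesis
      using X x by (simp add: P_def a_minus_def E.hom_nat_pow eval_var)
  qed
  have root_iff: "is_root P x \<longleftrightarrow> x \<in> carrier L \<and> x [^] q = x" for x
    unfolding is_root_def using P0 by (cases "x \<in> carrier L") (simp_all add: eval_P)
  \<comment> \<open>If the square of Y = X - a divided P = Y^q - Y with quotient g, then Y *
    (Y^(q-2) - g) = 1. Evaluating at the root \<open>a\<close> turns this into 0 = 1.\<close>
  have simple: "alg_mult P a \<le> 1" for a
  proof (rule ccontr)
    assume gt: "\<not> alg_mult P a \<le> 1"
    then have "is_root P a"
      using alg_mult_gt_zero_iff_is_root[OF P, of a] by simp
    then have a: "a \<in> carrier L" "a [^] q = a"
      by (auto simp: root_iff)
    let ?Y = "[\<one>, \<ominus> a]" and ?c = "poly_of_const a"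
    have Y: "?Y \<in> carrier ?U"
      using a unfolding sym[OF univ_poly_carrier] polynomial_def by simp
    have c: "?c \<in> carrier ?U" "?c [^]\<^bsub>?U\<^esub> q = ?c"
      using a C.hom_nat_pow[of a q] by auto
    have "?Y = X \<oplus>\<^bsub>?U\<^esub> poly_of_const (\<ominus> a)"
      using a by (simp add: poly_of_const_def univ_poly_add var_def)
    then have Y_eq: "?Y = X \<ominus>\<^bsub>?U\<^esub> ?c"
      using a by (simp add: a_minus_def)
    have "?Y [^]\<^bsub>?U\<^esub> q = X [^]\<^bsub>?U\<^esub> q \<ominus>\<^bsub>?U\<^esub> ?c"
      using UP.frobenius_pow_diff[OF p char' X c(1), of e] c(2) unfolding Y_eq q_def by simp
    then have P_eq: "P = ?Y [^]\<^bsub>?U\<^esub> q \<ominus>\<^bsub>?U\<^esub> ?Y"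
      using X c(1) UP.nat_pow_closed[OF X, of q] unfolding P_def Y_eq
      by (simp del: UP.nat_pow_closed) (use UP.ring_axioms in algebra)
    have "?Y [^]\<^bsub>?U\<^esub> (2::nat) pdivides P"
      using le_alg_mult_imp_pdivides[OF a(1) P, of 2] gt by simp
    then obtain g where g: "g \<in> carrier ?U" "P = ?Y [^]\<^bsub>?U\<^esub> (2::nat) \<otimes>\<^bsub>?U\<^esub> g"
      unfolding pdivides_def by (auto simp: factor_def)
    interpret E: ring_hom_ring ?U L "\<lambda>f. eval f a"
      using eval_ring_hom[OF carrier_is_subring a(1)] .
    let ?Z = "?Y [^]\<^bsub>?U\<^esub> (q - 2)"
    have Z: "?Z \<in> carrier ?U" using Y by simp
    have "?Y [^]\<^bsub>?U\<^esub> q = ?Y [^]\<^bsub>?U\<^esub> (2::nat) \<otimes>\<^bsub>?U\<^esub> ?Z"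
      using q2 by (metis UP.nat_pow_mult[OF Y] le_add_diff_inverse)
    then have "?Y \<otimes>\<^bsub>?U\<^esub> (?Y \<otimes>\<^bsub>?U\<^esub> (?Z \<ominus>\<^bsub>?U\<^esub> g)) = ?Y \<otimes>\<^bsub>?U\<^esub> \<one>\<^bsub>?U\<^esub>"
      using Y Z g P_eq by (intro UP.cancel_square_step) (simp_all add: numeral_2_eq_2)
    then have "?Y \<otimes>\<^bsub>?U\<^esub> (?Z \<ominus>\<^bsub>?U\<^esub> g) = \<one>\<^bsub>?U\<^esub>"
      using Y Z g by (subst (asm) UP.m_lcancel) (auto simp: univ_poly_zero)
    then have "eval ?Y a \<otimes> eval (?Z \<ominus>\<^bsub>?U\<^esub> g) a = \<one>"
      using Y Z g by (metis E.hom_mult E.hom_one UP.minus_closed)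
    moreover have "eval ?Y a = \<zero>"
      using a by (simp add: r_neg)
    ultimately show False
      using E.hom_closed[of "?Z \<ominus>\<^bsub>?U\<^esub> g"] Z g by simp
  qed
  have count: "count (roots P) x = (if is_root P x then 1 else 0)" for x
    using simple[of x] alg_mult_gt_zero_iff_is_root[OF P, of x]
    unfolding alg_mult_eq_count_roots[OF P, symmetric] by auto
  \<comment> \<open>With all multiplicities equal to one, the root multiset is a set. Over an
    algebraically closed field its size is the degree \<open>q\<close>.\<close>
  have "roots P = mset_set {x. is_root P x}"
    using finite_number_of_roots[OF P] by (intro multiset_eqI) (simp add: count)
  then have "card {x. is_root P x} = size (roots P)"
    by simp
  also have "\<dots> = q"
    using roots_over_carrier[OF P] \<open>degree P = q\<close> by (simp add: splitted_def)
  finally show ?thesis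
    by (simp add: root_iff)
qed

text \<open>The fixed points of the Frobenius power in an algebraic closure of the prime field form
  a field of the right size. It is then copied onto natural numbers, as the type of
  \<open>finite_field\<close> requires.\<close>

lemma finite_field_exists:
  fixes p e :: nat
  assumes p: "Factorial_Ring.prime p" and e: "e > 0"
  shows "\<exists>F :: nat ring. field F \<and> finite (carrier F) \<and> order F = p ^ e"
proof -
  interpret Z: residues_prime p "residue_ring (int p)"
    by unfold_locales (simp_all add: p)
  let ?L = "Z.alg_closure"
  interpret L: algebraic_closure ?L "Z.indexed_const ` carrier (residue_ring (int p))"
    by (rule Z.alg_closureE)
  interpret h: ring_hom_ring "residue_ring (int p)" ?L Z.indexed_const
    using Z.alg_closureE(2) by unfold_locales
  \<comment> \<open>At \<open>n = p\<close> this is zero, and the embedding into the closure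
    transfers the characteristic.\<close>
  have add_pow_Z: "[n] \<cdot>\<^bsub>residue_ring (int p)\<^esub> \<one>\<^bsub>residue_ring (int p)\<^esub> = int n mod int p" for n
    by (induction n) (simp_all add: Z.res_zero_eq Z.res_one_eq Z.res_add_eq mod_simps add.commute)
  have h_add_pow: "Z.indexed_const ([n] \<cdot>\<^bsub>residue_ring (int p)\<^esub> \<one>\<^bsub>residue_ring (int p)\<^esub>)
      = [n] \<cdot>\<^bsub>?L\<^esub> \<one>\<^bsub>?L\<^esub>" for n :: nat
    by (induction n) simp_all
  have char: "[p] \<cdot>\<^bsub>?L\<^esub> \<one>\<^bsub>?L\<^esub> = \<zero>\<^bsub>?L\<^esub>"
    using h_add_pow[of p] h.hom_zero by (simp add: add_pow_Z Z.res_zero_eq)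
  define K where "K = {x \<in> carrier ?L. x [^]\<^bsub>?L\<^esub> (p ^ e) = x}"
  interpret K: field "?L\<lparr>carrier := K\<rparr>"
    using L.subfield_iff(2)[OF L.frobenius_fixed_points_subfield[OF p char]] by (simp add: K_def)
  have card: "card K = p ^ e"
    using L.card_frobenius_fixed_points[OF p char e] by (simp add: K_def)
  then have fin: "finite K"
    using prime_gt_0_nat[OF p] by (intro card_ge_0_finite) simp
  then obtain f :: "_ \<Rightarrow> nat" where f: "inj_on f K"
    using finite_imp_inj_to_nat_seg by metis
  show ?thesis
  proof (intro exI conjI)
    show "field (image_ring f (?L\<lparr>carrier := K\<rparr>))"
      using f by (intro K.inj_imp_image_ring_is_field) simp
  qed (use fin f card in \<open>simp_all add: image_ring_carrier order_def card_image\<close>)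
qed

section \<open>Embedding graphs into Paley graphs\<close>

text \<open>Any injection of the vertices into the clique works: \<open>G\<close> has no loops, so
  the images of adjacent vertices are distinct members of \<open>K\<close>.\<close>

lemma is_subgraph_of_clique:
  assumes G: "pair_graph G" and P: "pair_wf_digraph P"
    and K: "K \<subseteq> pverts P" "finite K" "card (pverts G) \<le> card K"
    and clique: "\<And>u v. u \<in> K \<Longrightarrow> v \<in> K \<Longrightarrow> u \<noteq> v \<Longrightarrow> (u, v) \<in> parcs P"
  shows "is_subgraph_of G P"
proof -
  interpret G: pair_graph G by (rule G)
  obtain f where f: "f ` pverts G \<subseteq> K" "inj_on f (pverts G)"
    using card_le_inj[OF G.pair_finite_verts K(2,3)] by blast
  \<comment> \<open>Arcs are pairs of vertices, so the vertex map acts on both components and the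
    head and tail remain the projections.\<close>
  define h where "h = \<lparr>iso_verts = f, iso_arcs = map_prod f f, iso_head = snd, iso_tail = fst\<rparr>"
  have wf: "fst a \<in> pverts G" "snd a \<in> pverts G" if "a \<in> parcs G" for a
    using that G.arc_fst_in_verts G.arc_snd_in_verts by auto
  have iso: "pre_digraph.digraph_isomorphism (with_proj G) h"
    unfolding pre_digraph.digraph_isomorphism_def
  proof (intro conjI)
    show "inj_on (iso_arcs h) (arcs (with_proj G))"
      using wf inj_onD[OF f(2)]
      by (intro inj_onI) (auto simp: h_def prod_eq_iff)
  qed (use f G.wf_digraph_axioms in \<open>auto simp: h_def\<close>)
  have "subgraph (app_iso h (with_proj G)) (with_proj P)"
    unfolding subgraph_def
  proof (intro conjI)
    show "arcs (app_iso h (with_proj G)) \<subseteq> arcs (with_proj P)"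
    proof
      fix b assume "b \<in> arcs (app_iso h (with_proj G))"
      then obtain a where a: "a \<in> parcs G" "b = (f (fst a), f (snd a))"
        by (auto simp: h_def)
      then have "f (fst a) \<noteq> f (snd a)"
        using wf[OF a(1)] G.pair_no_loops[OF a(1)] inj_onD[OF f(2)] by blast
      then show "b \<in> arcs (with_proj P)"
        using clique f(1) wf[OF a(1)] a(2) by auto
    qed
    show "wf_digraph (with_proj P)"
      using P by (simp add: wf_digraph_wp_iff)
    show "wf_digraph (app_iso h (with_proj G))"
      using G.wf_digraphI_app_iso[OF iso] .
  qed (use f K(1) in \<open>auto simp: h_def compatible_def\<close>)
  then show ?thesis
    unfolding is_subgraph_of_def digraph_iso_def using iso by blast
qed

text \<open>With \<open>s = q ^ m\<close> the Paley graph lives on the field with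
  \<open>s\<^sup>2\<close> elements, whose subfield of Frobenius fixed points supplies the
  clique.\<close>

lemma is_subgraph_of_paley_graph:
  assumes q: "primepow q" "odd q" and G: "pair_graph G" and m: "m > 0"
    and k: "card (pverts G) \<le> q ^ m"
  shows "is_subgraph_of G (paley_graph ((q\<^sup>2) ^ m))"
proof -
  obtain p e0 where p: "Factorial_Ring.prime p" and e0: "e0 > 0" and q_eq: "q = p ^ e0"
    using q(1) by (auto simp: primepow_def)
  define e where "e = e0 * m"
  have e: "e > 0" and qm: "q ^ m = p ^ e" and r: "(q\<^sup>2) ^ m = (p ^ e)\<^sup>2"
    using e0 m by (simp_all add: e_def q_eq flip: power_mult) (simp add: mult_ac)
  have "odd p" using q(2) q_eq e0 by simp
  define F where "F = finite_field ((p ^ e)\<^sup>2)"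
  have F: "field F" "finite (carrier F)" "order F = (p ^ e)\<^sup>2"
    \<comment> \<open>Existence of a field of this order is what makes the choice in
      \<open>finite_field\<close> meaningful.\<close>
    using someI_ex[OF finite_field_exists[OF p, of "e * 2"]] e
    by (simp_all add: F_def finite_field_def power_mult)
  interpret F: field F by (rule F)
  let ?K = "{x \<in> carrier F. x [^]\<^bsub>F\<^esub> (p ^ e) = x}"
  note clique = F.frobenius_fixed_points_clique[OF F(2) p \<open>odd p\<close> e F(3)]
  show ?thesis
    unfolding r
  proof (rule is_subgraph_of_clique[OF G])
    show "pair_wf_digraph (paley_graph ((p ^ e)\<^sup>2))"
      by unfold_locales (auto simp: paley_graph_def Let_def)
    show "?K \<subseteq> pverts (paley_graph ((p ^ e)\<^sup>2))"
      by (auto simp: paley_graph_def Let_def F_def)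
    show "finite ?K" using F(2) by simp
    show "card (pverts G) \<le> card ?K"
      using k clique(1) unfolding qm by linarith
    fix u v assume "u \<in> ?K" "v \<in> ?K" "u \<noteq> v"
    then show "(u, v) \<in> parcs (paley_graph ((p ^ e)\<^sup>2))"
      using clique(2)[of u v] by (auto simp: paley_graph_def Let_def simp flip: F_def)
  qed
qed

text \<open>The index ranges over \<open>n \<ge> 1\<close>, while the ceiling is at most 0 when
  \<open>k \<le> q\<close>; hence the \<open>max 1\<close> in the bound.\<close>

theorem theorem6p1:
  fixes q k :: nat and G :: "'a pair_pre_digraph"
  assumes "primepow q" and "odd q"
    and "pair_graph G" and "card (pverts G) = k"
  shows "paley_index q G \<le> enat (nat (max 1 \<lceil>log 3 (log (real q) (real k))\<rceil>))"
proof -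
  define n where "n = nat (max 1 \<lceil>log 3 (log (real q) (real k))\<rceil>)"
  have n: "n \<ge> 1" "log 3 (log (real q) (real k)) \<le> real n"
    unfolding n_def by linarith+
  have q: "q > 1" using primepow_gt_Suc_0[OF assms(1)] by simp
  have "k \<le> q ^ (3 ^ n)"
  \<comment> \<open>The outer logarithm can be inverted only for a positive argument. Otherwise
    \<open>k \<le> 1\<close>, and the size bound is immediate.\<close>
  proof (cases "log (real q) (real k) > 0")
    case True
    \<comment> \<open>The convention that the logarithm of 0 is 0 rules out \<open>k = 0\<close>
      here.\<close>
    then have "k > 0" by (intro Nat.gr0I) (simp add: log_def)
    have "log (real q) (real k) \<le> 3 powr real n"
      using True n(2) by (simp add: log_le_iff)
    also have "\<dots> = real (3 ^ n)"
      by (simp add: powr_realpow)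
    finally have "real k \<le> real q powr real (3 ^ n)"
      using q \<open>k > 0\<close> by (simp add: log_le_iff)
    also have "\<dots> = real (q ^ (3 ^ n))"
      using q by (simp add: powr_realpow del: of_nat_power)
    finally show ?thesis by linarith
  next
    case False
    then have "k \<le> 1"
      using q zero_less_log_cancel_iff[of "real q" "real k"] by (cases "k > 1") auto
    also have "1 \<le> q ^ (3 ^ n)"
      using q by simp
    finally show ?thesis .
  qed
  then have "is_subgraph_of G (paley_seq q n)"
    unfolding paley_seq_def using assms by (intro is_subgraph_of_paley_graph) auto
  then show ?thesis
    unfolding paley_index_def n_def[symmetric] using n by (intro Inf_lower imageI) auto
qed

end
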